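(* Let $p>3$ be a prime and let $d$ be an integer with $0\le d\le p-1$. If $d$ is odd, then $$\frac{1}{p}\sum_{k=0}^{p-1}\binom{k}{d}_2\equiv\frac{(-1)^{\frac{d+1}2}}{2}\bigg(\sum_{k=1}^{(d-1)/2}\frac{(-1)^k}{k}-3\sum_{\substack{1\le k\le (d-1)/2\\ 3\mid k+p}}\frac{(-1)^k}{k}\bigg)\pmod{p}.$$ If $d$ is even, then $$\frac{1}{p}\bigg((-1)^{\frac d2}\sum_{k=0}^{p-1}\binom{k}{d}_2-(-1)^{\frac{p-1}2}\bigg)\equiv 3\left(\frac{-2}{p}\right)\frac{S_{(p-(\frac{3}{p}))/2}}{p}-2\sum_{0\le j<d/2}\frac{(-1)^j}{2j+1}+3\sum_{\substack{0\le j<d/2\\ 3\nmid p-2j-1}}\frac{(-1)^j}{2j+1}\pmod{p}.$$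
   Context: The trinomial coefficients $\binom{n}{k}_2$ are defined for integers $n\ge 0$ by $(1+x+x^{-1})^n=\sum_{k=-n}^{n}\binom{n}{k}_2x^k$. The sequence $\{S_n\}$ is defined by $S_0=0$, $S_1=1$, $S_{n+1}=4S_n-S_{n-1}$ for $n\ge1$. $\left(\frac{\cdot}{p}\right)$ denotes the Legendre symbol. Congruences between rational numbers whose denominators are prime to $p$ are understood in the ring of rationals with denominator prime to $p$ (i.e. $a\equiv b \pmod p$ means $(a-b)/p$ has denominator prime to $p$). *)

theory Defs
  imports
    "HOL-Number_Theory.Number_Theory"
    "HOL-Computational_Algebra.Formal_Laurent_Series"
begin

text \<open>
  Coefficient of \<open>x\<^sup>k\<close> in the Laurent polynomial \<open>(1 + x + 1/x)\<^sup>n\<close>;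
  it is \<open>0\<close> for \<open>\<bar>k\<bar> > n\<close>.
\<close>
definition trinomial :: "nat \<Rightarrow> int \<Rightarrow> int" where
  "trinomial n k = fls_nth ((1 + fls_X + fls_X_inv :: int fls) ^ n) k"

fun S_seq :: "nat \<Rightarrow> int" where
  "S_seq 0 = 0"
| "S_seq (Suc 0) = 1"
| "S_seq (Suc (Suc n)) = 4 * S_seq (Suc n) - S_seq n"

text \<open>\<open>quotient_of\<close> returns the numerator and denominator in lowest terms.\<close>
definition p_integral :: "nat \<Rightarrow> rat \<Rightarrow> bool" where
  "p_integral p x \<longleftrightarrow> coprime (snd (quotient_of x)) (int p)"

text \<open>
  Congruence modulo \<open>p\<close> in the ring of rationals with denominator prime to \<open>p\<close>.
  Both sides are required to lie in that ring.
\<close>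
definition rat_cong :: "nat \<Rightarrow> rat \<Rightarrow> rat \<Rightarrow> bool" where
  "rat_cong p a b \<longleftrightarrow>
     p_integral p a \<and> p_integral p b \<and> p_integral p ((a - b) / of_nat p)"

end

theory Submission
  imports Defs
begin

text \<open>
  Let \<open>F d\<close> be the sum of the coefficients of \<open>x\<^sup>d\<close> in \<open>T\<^sup>k\<close>, \<open>k < p\<close>, where \<open>T = 1 + x + 1/x\<close>.
  As \<open>(T - 1) (1 + T + \<dots> + T\<^bsup>p-1\<^esup>) = T\<^sup>p - 1\<close>, the sum \<open>F (d - 1) + F (d + 1)\<close> is a coefficient of
  \<open>T\<^sup>p - 1\<close>, and these are known modulo \<open>p\<^sup>2\<close> from \<open>(1 - x)\<^sup>p (1 + x + x\<^sup>2)\<^sup>p = (1 - x\<^sup>3)\<^sup>p\<close>.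
  Telescoping gives \<open>F d\<close> from \<open>F 1\<close> (where symmetry gives \<open>2 F 1\<close>) or from \<open>F 0\<close>.
  For \<open>F 0\<close> one telescopes back from \<open>F (p - 1) = 1\<close>; modulo \<open>p\<^sup>2\<close> the result is half the trace of
  \<open>(1 - \<zeta>)\<^sup>p\<close> for a primitive 12th root of unity \<open>\<zeta>\<close>, up to sign and a constant. Since
  \<open>(1 - \<zeta>)\<^sup>2 = - \<zeta> (2 - \<surd>3)\<close> and \<open>S\<^sub>n\<close> is the coefficient of \<open>\<surd>3\<close> in \<open>(2 + \<surd>3)\<^sup>n\<close>, this trace is
  an expression in \<open>S\<close>. Roots of unity are replaced by periodic integer sequences on
  which \<open>\<zeta>\<close> acts as a shift.
\<close>

section \<open>The prime row of the trinomial triangle\<close>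

lemma trinomial_0: "trinomial 0 k = (if k = 0 then 1 else 0)"
  by (simp add: trinomial_def)

lemma trinomial_Suc:
  "trinomial (Suc n) k = trinomial n (k - 1) + trinomial n k + trinomial n (k + 1)"
  by (simp add: trinomial_def distrib_right fls_X_times_conv_shift fls_X_inv_times_conv_shift)

lemma trinomial_uminus: "trinomial n (- k) = trinomial n k"
proof (induction n arbitrary: k)
  case (Suc n)
  show ?case
    using Suc.IH[of "k + 1"] Suc.IH[of "k - 1"] Suc.IH[of k] by (simp add: trinomial_Suc)
qed (simp add: trinomial_0)

lemma trinomial_eq_0: "int n < k \<Longrightarrow> trinomial n k = 0"
  by (induction n arbitrary: k) (simp_all add: trinomial_0 trinomial_Suc)

lemma trinomial_eq_0': "k < - int n \<Longrightarrow> trinomial n k = 0"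
  using trinomial_eq_0[of n "- k"] by (simp add: trinomial_uminus)

lemma trinomial_self: "trinomial n (int n) = 1"
  by (induction n) (simp_all add: trinomial_0 trinomial_Suc trinomial_eq_0)

text \<open>As T - 1 = x + 1/x, this is (T - 1) (1 + T + ... + T^(n-1)) = T^n - 1 read off at
  x^d.\<close>

lemma sum_trinomial_shift:
  "(\<Sum>k<n. trinomial k (d - 1)) + (\<Sum>k<n. trinomial k (d + 1)) = trinomial n d - trinomial 0 d"
  by (induction n) (simp_all add: trinomial_Suc)

text \<open>Since 1 + x + x^2 = x (1 + x + 1/x), passing to ordinary polynomials shifts the index by
  n.\<close>

lemma coeff_trinomial_power: "coeff ([:1, 1, 1:] ^ n) i = trinomial n (int i - int n)"
proof (induction n arbitrary: i)
  case 0
  then show ?case by (simp add: trinomial_0)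
next
  case (Suc n)
  have eq: "[:1, 1, 1:] ^ Suc n = [:1, 1, 1:] ^ n + pCons 0 ([:1, 1, 1:] ^ n + pCons (0::int) ([:1, 1, 1:] ^ n))"
    by simp
  show ?case
    unfolding eq coeff_add coeff_pCons
    by (cases i; cases "i - 1") (simp_all add: Suc trinomial_Suc trinomial_eq_0' algebra_simps)
qed

lemma coeff_one_minus_X_power:
  "coeff ([:1, -1:] ^ n) i = (-1) ^ i * int (n choose i)"
  by (cases "i \<le> n") (simp_all add: coeff_linear_poly_power coeff_eq_0 degree_linear_power)

lemma coeff_one_minus_X_cubed_power:
  "coeff ([:1, 0, 0, -1:] ^ n) m =
     (if 3 dvd m then (-1) ^ (m div 3) * int (n choose (m div 3)) else 0)"
proof (induction n arbitrary: m)
  case 0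
  then show ?case by (auto elim!: dvdE)
next
  case (Suc n)
  have eq: "[:1, 0, 0, -1:] ^ Suc n = [:1, 0, 0, -1:] ^ n - monom (1::int) 3 * [:1, 0, 0, -1:] ^ n"
    by (simp add: monom_altdef numeral_3_eq_3)
  show ?case
  proof (cases "m < 3")
    case True
    then show ?thesis
      unfolding eq coeff_diff coeff_monom_mult by (auto simp: Suc elim!: dvdE)
  next
    case False
    then obtain l where l: "m = l + 3"
      using le_Suc_ex by (metis add.commute not_less)
    show ?thesis
      unfolding eq coeff_diff coeff_monom_mult by (simp add: Suc l algebra_simps)
  qed
qed

text \<open>Coefficients of x^m are compared in (1 - x)^n (1 + x + x^2)^n = (1 - x^3)^n.\<close>

lemma trinomial_convolution:
  "(\<Sum>i\<le>m. (-1) ^ i * int (n choose i) * trinomial n (int (m - i) - int n)) =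
     (if 3 dvd m then (-1) ^ (m div 3) * int (n choose (m div 3)) else 0)"
proof -
  have "[:1, -1:] ^ n * [:1, 1, 1:] ^ n = [:1, 0, 0, -1 :: int:] ^ n"
    by (simp flip: power_mult_distrib)
  from arg_cong[OF this, of "\<lambda>q. coeff q m"] show ?thesis
    by (simp add: coeff_mult coeff_one_minus_X_power coeff_trinomial_power
        coeff_one_minus_X_cubed_power)
qed

section \<open>Binomial and trinomial coefficients of row p modulo p and p^2\<close>

text \<open>Absorption gives m C(p, m) = p C(p - 1, m - 1), and C(p - 1, k) is (-1)^k modulo p by
  Pascal's rule. Keeping the factor m avoids inverses.\<close>

lemma choose_prime_cong_mod_prime_sq:
  assumes "prime p" "0 < m" "m < p"
  shows "[int m * ((-1) ^ m * int (p choose m)) = - int p] (mod (int p)\<^sup>2)"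
proof -
  have *: "[(-1) ^ k * int ((p - 1) choose k) = 1] (mod int p)" if "k < p" for k
    using that
  proof (induction k)
    case (Suc k)
    have "p choose (Suc k) = ((p - 1) choose k) + ((p - 1) choose Suc k)"
      using assms by (metis Suc_pred' binomial_Suc_Suc gr0I not_less_zero)
    moreover have "int p dvd int (p choose Suc k)"
      using dvd_choose_prime[of "Suc k" p] Suc.prems assms by auto
    ultimately have "int p dvd int ((p - 1) choose k) + int ((p - 1) choose Suc k)"
      by simp
    then have "int p dvd (-1) ^ k * (int ((p - 1) choose k) + int ((p - 1) choose Suc k))"
      by simp
    then have "[(-1) ^ k * int ((p - 1) choose k) = (-1) ^ Suc k * int ((p - 1) choose Suc k)] (mod int p)"
      by (simp add: cong_iff_dvd_diff algebra_simps)
    then show ?case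
      using Suc by (meson Suc_lessD cong_sym cong_trans)
  qed simp
  obtain l where l: "m = Suc l"
    using assms by (cases m) auto
  have "m * (p choose m) = p * ((p - 1) choose l)"
    unfolding l using assms by (metis binomial_absorption)
  then have "int m * int (p choose m) = int p * int ((p - 1) choose l)"
    by (metis of_nat_mult)
  then have "int m * ((-1) ^ m * int (p choose m)) = - int p * ((-1) ^ l * int ((p - 1) choose l))"
    by (simp add: l mult.left_commute)
  moreover have "[int p * ((-1) ^ l * int ((p - 1) choose l)) = int p * 1] (mod int p * int p)"
    using *[of l] assms l by (simp only: cong_iff_dvd_diff flip: right_diff_distrib) simp
  ultimately show ?thesis
    by (simp add: power2_eq_square cong_minus_minus_iff)
qed

lemma prime_dvd_alternating_choose:
  assumes "prime p" "0 < i" "i < p"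
  shows "int p dvd (-1) ^ i * int (p choose i)"
  using dvd_choose_prime[of i p] assms by auto

text \<open>In the convolution p divides the right-hand side and every term with i > 0, hence also
  the term i = 0.\<close>

lemma trinomial_prime_row_dvd:
  assumes "prime p" "0 < m" "m < p"
  shows "int p dvd trinomial p (int m - int p)"
  using assms(2,3)
proof (induction m rule: less_induct)
  case (less m)
  let ?t = "\<lambda>i. (-1) ^ i * int (p choose i) * trinomial p (int (m - i) - int p)"
  have "(\<Sum>i\<le>m. ?t i) = ?t 0 + (\<Sum>i\<in>{0<..m}. ?t i)"
    by (subst sum.remove[of _ 0]) (auto intro!: sum.cong)
  moreover have "int p dvd (\<Sum>i\<in>{0<..m}. ?t i)"
    using less.prems assms by (intro dvd_sum dvd_mult2 prime_dvd_alternating_choose) auto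
  moreover have "int p dvd (\<Sum>i\<le>m. ?t i)"
    unfolding trinomial_convolution
    using less.prems assms(1) prime_dvd_alternating_choose[of p "m div 3"] by (auto elim!: dvdE)
  ultimately show ?case
    by (simp add: dvd_add_left_iff)
qed

lemma cong_drop_multiple:
  fixes a r s m :: int
  assumes "r = a + s" "m dvd s"
  shows "[a = r] (mod m)"
  using assms by (simp add: cong_iff_dvd_diff)

text \<open>Modulo p^2 only the end terms of the convolution survive: in the others both factors are
  multiples of p. After multiplication by m, the term i = m moved to the right contributes p, and
  the right-hand side -3 p if 3 divides m.\<close>

lemma trinomial_prime_row_cong:
  assumes "prime p" "0 < m" "m < p"
  shows "[int m * trinomial p (int m - int p) = (if 3 dvd m then - 2 else 1) * int p] (mod (int p)\<^sup>2)"
proof -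
  let ?e = "\<lambda>i. (-1) ^ i * int (p choose i)"
  let ?t = "\<lambda>i. ?e i * trinomial p (int (m - i) - int p)"
  let ?R = "if 3 dvd m then ?e (m div 3) else 0"
  have "(\<Sum>i\<le>m. ?t i) = ?t 0 + ?t m + (\<Sum>i\<in>{0<..<m}. ?t i)"
    using assms by (subst sum.remove[of _ 0], simp, simp, subst sum.remove[of _ m])
      (auto intro!: sum.cong)
  moreover have "(int p)\<^sup>2 dvd (\<Sum>i\<in>{0<..<m}. ?t i)"
    unfolding power2_eq_square
    using assms by (intro dvd_sum mult_dvd_mono prime_dvd_alternating_choose trinomial_prime_row_dvd) auto
  ultimately have "[?t 0 + ?t m = ?R] (mod (int p)\<^sup>2)"
    unfolding trinomial_convolution[where n = p and m = m]
    by (intro cong_drop_multiple) simp_all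
  moreover have "?t m = ?e m"
    by (simp add: trinomial_uminus trinomial_self)
  ultimately have "[?t 0 + ?e m = ?R] (mod (int p)\<^sup>2)"
    by (simp only:)
  then have "[int m * (?t 0 + ?e m) - int m * ?e m = int m * ?R - int m * ?e m] (mod (int p)\<^sup>2)"
    by (intro cong_diff cong_mult) auto
  then have 1: "[int m * trinomial p (int m - int p) = int m * ?R - int m * ?e m] (mod (int p)\<^sup>2)"
    by (simp add: algebra_simps)
  have 2: "[int m * ?e m = - int p] (mod (int p)\<^sup>2)"
    using assms by (rule choose_prime_cong_mod_prime_sq)
  have 3: "[int m * ?R = (if 3 dvd m then - 3 * int p else 0)] (mod (int p)\<^sup>2)"
  proof (cases "3 dvd m")
    case True
    then obtain l where l: "m = 3 * l" by auto
    have "[3 * (int l * ?e l) = 3 * (- int p)] (mod (int p)\<^sup>2)"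
      using assms l by (intro cong_mult choose_prime_cong_mod_prime_sq) auto
    with l show ?thesis by (simp add: mult.assoc)
  qed auto
  show ?thesis
    using cong_trans[OF 1 cong_diff[OF 3 2]] by (auto split: if_splits)
qed

text \<open>The convolution at m = p: its right-hand side vanishes because 3 does not divide p, and
  the term i = p is -1 because p is odd.\<close>

lemma trinomial_prime_0_cong:
  assumes "prime p" "p > 3"
  shows "[trinomial p 0 = 1] (mod (int p)\<^sup>2)"
proof -
  let ?e = "\<lambda>i. (-1) ^ i * int (p choose i)"
  let ?t = "\<lambda>i. ?e i * trinomial p (int (p - i) - int p)"
  have np: "\<not> 3 dvd p"
    using assms by (auto simp: prime_nat_iff)
  have odd: "odd p"
    using assms by (simp add: prime_odd_nat)
  have "(\<Sum>i\<le>p. ?t i) = ?t 0 + ?t p + (\<Sum>i\<in>{0<..<p}. ?t i)"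
    using assms by (subst sum.remove[of _ 0], simp, simp, subst sum.remove[of _ p])
      (auto intro!: sum.cong)
  moreover have "(int p)\<^sup>2 dvd (\<Sum>i\<in>{0<..<p}. ?t i)"
    unfolding power2_eq_square
    using assms by (intro dvd_sum mult_dvd_mono prime_dvd_alternating_choose trinomial_prime_row_dvd) auto
  moreover have "?t p = - 1"
    using odd by (simp add: trinomial_uminus trinomial_self)
  ultimately have "0 = (trinomial p 0 - 1) + (\<Sum>i\<in>{0<..<p}. ?t i)"
      and "(int p)\<^sup>2 dvd (\<Sum>i\<in>{0<..<p}. ?t i)"
    using trinomial_convolution[where n = p and m = p] np by simp_all
  then have "[trinomial p 0 - 1 = 0] (mod (int p)\<^sup>2)"
    by (rule cong_drop_multiple)
  then show ?thesis
    by (simp add: cong_iff_dvd_diff)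
qed

section \<open>Shift operators and quadratic characters\<close>

text \<open>With E the shift of sequences, this is the operator E^u + b E^v. It stands for
  multiplication by zeta^u + b zeta^v when c m is a linear functional of zeta^m.\<close>

definition two_shift :: "int \<Rightarrow> int \<Rightarrow> int \<Rightarrow> (int \<Rightarrow> int) \<Rightarrow> int \<Rightarrow> int" where
  "two_shift u v b c m = c (m + u) + b * c (m + v)"

lemma sum_choose_Suc:
  "(\<Sum>k\<le>Suc n. int (Suc n choose k) * g k) = (\<Sum>k\<le>n. int (n choose k) * (g k + g (Suc k)))"
proof -
  have "(\<Sum>k\<le>n. int (n choose k) * g k) = (\<Sum>k\<le>Suc n. int (n choose k) * g k)"
    by simp
  also have "\<dots> = g 0 + (\<Sum>k\<le>n. int (n choose Suc k) * g (Suc k))"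
    by (subst sum.atMost_Suc_shift) simp
  finally show ?thesis
    by (subst sum.atMost_Suc_shift) (simp add: algebra_simps sum.distrib)
qed

text \<open>The operators E^u and b E^v commute, so the binomial theorem applies.\<close>

lemma two_shift_funpow:
  "(two_shift u v b ^^ n) c m =
     (\<Sum>k\<le>n. int (n choose k) * (b ^ k * c (m + (int n - int k) * u + int k * v)))"
proof (induction n arbitrary: m)
  case (Suc n)
  show ?case
    unfolding sum_choose_Suc
    by (simp add: two_shift_def[of _ _ _ "(two_shift u v b ^^ n) c"] Suc sum.distrib sum_distrib_left algebra_simps)
qed simp

lemma two_shift_frobenius:
  assumes "prime p"
  shows "[(two_shift u v b ^^ p) c m = c (m + int p * u) + b ^ p * c (m + int p * v)] (mod int p)"
proof -
  let ?t = "\<lambda>k. int (p choose k) * (b ^ k * c (m + (int p - int k) * u + int k * v))"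
  have "p > 0"
    using assms by (simp add: prime_gt_0_nat)
  then have "(\<Sum>k\<le>p. ?t k) = ?t 0 + ?t p + (\<Sum>k\<in>{0<..<p}. ?t k)"
    by (subst sum.remove[of _ 0], simp, simp, subst sum.remove[of _ p]) (auto intro!: sum.cong)
  moreover have "int p dvd (\<Sum>k\<in>{0<..<p}. ?t k)"
    using assms by (intro dvd_sum dvd_mult2) (auto intro!: dvd_choose_prime)
  ultimately show ?thesis
    unfolding two_shift_funpow by (simp add: cong_iff_dvd_diff)
qed

text \<open>An operator squaring to the scalar a on c is a formal square root of a; for p = 2 n + 1
  its p-th power produces the a^((p-1)/2) of Euler's criterion.\<close>

lemma two_shift_funpow_odd:
  assumes "\<And>m. two_shift u v b (two_shift u v b c) m = a * c m"
  shows "(two_shift u v b ^^ Suc (2 * n)) c m = a ^ n * two_shift u v b c m"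
proof -
  have scale: "two_shift u v b (\<lambda>m. r * f m) = (\<lambda>m. r * two_shift u v b f m)" for r f
    by (rule ext) (simp add: two_shift_def algebra_simps)
  have sq: "two_shift u v b (two_shift u v b c) = (\<lambda>m. a * c m)"
    using assms by blast
  have "(two_shift u v b ^^ Suc (2 * n)) c = (\<lambda>m. a ^ n * two_shift u v b c m)"
  proof (induction n)
    case (Suc n)
    have "(two_shift u v b ^^ Suc (2 * Suc n)) c =
        two_shift u v b (two_shift u v b ((two_shift u v b ^^ Suc (2 * n)) c))"
      by simp
    then show ?case
      unfolding Suc scale sq by (simp add: algebra_simps)
  qed simp
  then show ?thesis by (rule fun_cong)
qed

text \<open>
  Periodic solutions of the linear recurrences with characteristic polynomials
  \<open>x\<^sup>4 - x\<^sup>2 + 1\<close> (12th roots of unity) and \<open>x\<^sup>4 + 1\<close> (8th roots of unity): \<open>chi12\<close> and \<open>psi8\<close>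
  are the quadratic characters of \<open>\<rat>(\<surd>3)\<close> and \<open>\<rat>(\<surd>-2)\<close>, and \<open>ram12\<close> is half the Ramanujan
  sum \<open>c\<^sub>1\<^sub>2\<close>.
\<close>

definition chi12 :: "int \<Rightarrow> int" where
  "chi12 k = (if k mod 12 \<in> {1, 11} then 1 else if k mod 12 \<in> {5, 7} then -1 else 0)"

definition psi8 :: "int \<Rightarrow> int" where
  "psi8 k = (if k mod 8 \<in> {1, 3} then 1 else if k mod 8 \<in> {5, 7} then -1 else 0)"

definition ram12 :: "int \<Rightarrow> int" where
  "ram12 k = (if k mod 12 = 0 then 2 else if k mod 12 \<in> {2, 10} then 1
     else if k mod 12 \<in> {4, 8} then -1 else if k mod 12 = 6 then -2 else 0)"

lemma mod12_cases:
  fixes k :: int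
  obtains "k mod 12 = 0" | "k mod 12 = 1" | "k mod 12 = 2" | "k mod 12 = 3" | "k mod 12 = 4"
    | "k mod 12 = 5" | "k mod 12 = 6" | "k mod 12 = 7" | "k mod 12 = 8" | "k mod 12 = 9"
    | "k mod 12 = 10" | "k mod 12 = 11"
proof -
  have "0 \<le> k mod 12" "k mod 12 < 12" by simp_all
  then have "k mod 12 \<in> {0,1,2,3,4,5,6,7,8,9,10,11}"
    by (simp, presburger)
  then show ?thesis using that by auto
qed

lemma chi12_add_mod: "chi12 (k + j) = chi12 (k mod 12 + j)"
  by (simp add: chi12_def mod_add_left_eq)

lemma ram12_add_mod: "ram12 (k + j) = ram12 (k mod 12 + j)"
  by (simp add: ram12_def mod_add_left_eq)

text \<open>A 12th root of unity satisfies x^2 + x^(-2) = 1. The form \<open>k + (-2)\<close> lets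
  \<open>chi12_add_mod\<close> rewrite both shifts.\<close>

lemma chi12_rec: "chi12 (k + 2) + chi12 (k + (-2)) = chi12 k"
  unfolding chi12_add_mod[of k "2"] chi12_add_mod[of k "-2"]
  by (rule mod12_cases[of k]) (simp_all add: chi12_def)

lemma ram12_rec: "ram12 (k + 2) + ram12 (k + (-2)) = ram12 k"
  unfolding ram12_add_mod[of k "2"] ram12_add_mod[of k "-2"]
  by (rule mod12_cases[of k]) (simp_all add: ram12_def)

lemma mod8_cases:
  fixes k :: int
  obtains "k mod 8 = 0" | "k mod 8 = 1" | "k mod 8 = 2" | "k mod 8 = 3" | "k mod 8 = 4"
    | "k mod 8 = 5" | "k mod 8 = 6" | "k mod 8 = 7"
proof -
  have "0 \<le> k mod 8" "k mod 8 < 8" by simp_all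
  then have "k mod 8 \<in> {0,1,2,3,4,5,6,7}"
    by (simp, presburger)
  then show ?thesis using that by auto
qed

lemma psi8_add_mod: "psi8 (k + j) = psi8 (k mod 8 + j)"
  by (simp add: psi8_def mod_add_left_eq)

lemma psi8_rec: "psi8 (k + 2) + psi8 (k + (-2)) = 0"
  unfolding psi8_add_mod[of k "2"] psi8_add_mod[of k "-2"]
  by (rule mod8_cases[of k]) (simp_all add: psi8_def)

lemma chi12_uminus: "chi12 (- k) = chi12 k"
  by (rule mod12_cases[of k]) (simp_all add: chi12_def zmod_zminus1_eq_if)

lemma psi8_uminus: "psi8 (- k) = - psi8 k"
  by (rule mod8_cases[of k]) (simp_all add: psi8_def zmod_zminus1_eq_if)

section \<open>Legendre symbols of 3 and -2 as periodic characters\<close>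

text \<open>Euler's criterion makes the two sides congruent; both lie in {-1, 0, 1}, so they differ
  by at most 2 < p.\<close>

lemma Legendre_eqI:
  assumes "prime p" "2 < p" "[a ^ ((p - 1) div 2) = e] (mod int p)" "e \<in> {-1, 0, 1}"
  shows "Legendre a (int p) = e"
proof -
  have "[Legendre a (int p) = e] (mod int p)"
    using euler_criterion[OF assms(1,2)] assms(3) by (rule cong_trans)
  then have "int p dvd Legendre a (int p) - e"
    by (simp add: cong_iff_dvd_diff)
  moreover have "\<bar>Legendre a (int p) - e\<bar> < int p"
    using assms(2,4) by (auto simp: Legendre_def)
  ultimately show ?thesis
    using zdvd_imp_le[of "int p" "\<bar>Legendre a (int p) - e\<bar>"] by auto
qed

lemma odd_prime_half:
  assumes "prime p" "p > 2"
  shows "p = Suc (2 * ((p - 1) div 2))"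
  using prime_odd_nat[OF assms(1)] assms by auto

lemma cong_mult_2_cancel:
  assumes "prime p" "p > 2" "[2 * a = 2 * b] (mod int p)"
  shows "[a = b] (mod int p)"
proof -
  have "coprime 2 (int p)"
    using prime_odd_nat[OF assms(1)] assms(2) by simp
  with assms(3) show ?thesis
    by (simp add: cong_mult_lcancel)
qed

text \<open>E + 1/E acts on \<open>chi12\<close> as a square root of 3, since E^2 + E^(-2) acts as
  1. At 0 its p-th power is 2 * 3^((p-1)/2) by squaring, and 2 * \<open>chi12 (int p)\<close> modulo
  p by Frobenius.\<close>

lemma Legendre_3_eq_chi12:
  assumes "prime p" "p > 2"
  shows "Legendre 3 (int p) = chi12 (int p)"
proof (rule Legendre_eqI[OF assms])
  let ?n = "(p - 1) div 2"
  have sq: "two_shift 1 (-1) 1 (two_shift 1 (-1) 1 chi12) m = 3 * chi12 m" for m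
    using chi12_rec[of m] by (simp add: two_shift_def algebra_simps)
  have "(two_shift 1 (-1) 1 ^^ p) chi12 0 = 3 ^ ?n * two_shift 1 (-1) 1 chi12 0"
    using two_shift_funpow_odd[OF sq, of ?n 0] odd_prime_half[OF assms] by metis
  also have "\<dots> = 2 * 3 ^ ?n"
    by (simp add: two_shift_def chi12_def)
  finally have "[2 * 3 ^ ?n = 2 * chi12 (int p)] (mod int p)"
    using two_shift_frobenius[OF assms(1), of 1 "-1" 1 chi12 0] by (simp add: chi12_uminus)
  then show "[3 ^ ?n = chi12 (int p)] (mod int p)"
    by (rule cong_mult_2_cancel[OF assms])
qed (auto simp: chi12_def)

text \<open>The same computation with E - 1/E, whose square E^2 - 2 + E^(-2) acts on
  \<open>psi8\<close> as -2; that \<open>psi8\<close> is odd offsets the minus sign.\<close>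

lemma Legendre_minus_2_eq_psi8:
  assumes "prime p" "p > 2"
  shows "Legendre (-2) (int p) = psi8 (int p)"
proof (rule Legendre_eqI[OF assms])
  let ?n = "(p - 1) div 2"
  have sq: "two_shift 1 (-1) (-1) (two_shift 1 (-1) (-1) psi8) m = - 2 * psi8 m" for m
    using psi8_rec[of m] by (simp add: two_shift_def algebra_simps)
  have "(two_shift 1 (-1) (-1) ^^ p) psi8 0 = (- 2) ^ ?n * two_shift 1 (-1) (-1) psi8 0"
    using two_shift_funpow_odd[OF sq, of ?n 0] odd_prime_half[OF assms] by metis
  also have "\<dots> = 2 * (- 2) ^ ?n"
    by (simp add: two_shift_def psi8_def)
  finally have "[2 * (- 2) ^ ?n = 2 * psi8 (int p)] (mod int p)"
    using two_shift_frobenius[OF assms(1), of 1 "-1" "-1" psi8 0] prime_odd_nat[OF assms(1)] assms(2)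
    by (simp add: psi8_uminus)
  then show "[(- 2) ^ ?n = psi8 (int p)] (mod int p)"
    by (rule cong_mult_2_cancel[OF assms])
qed (auto simp: psi8_def)

section \<open>Powers of 2 + sqrt 3 and of 1 - E\<close>

text \<open>\<open>(2 + \<surd>3)\<^sup>n = W_seq n + S_seq n \<surd>3\<close>\<close>

definition W_seq :: "nat \<Rightarrow> int" where
  "W_seq n = S_seq (Suc n) - 2 * S_seq n"

lemma W_seq_0: "W_seq 0 = 1"
  by (simp add: W_seq_def)

lemma S_seq_Suc_W: "S_seq (Suc n) = W_seq n + 2 * S_seq n"
  by (simp add: W_seq_def)

lemma W_seq_Suc: "W_seq (Suc n) = 2 * W_seq n + 3 * S_seq n"
  by (simp add: W_seq_def)

lemma W_S_pell: "(W_seq n)\<^sup>2 - 3 * (S_seq n)\<^sup>2 = 1"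
  by (induction n) (simp_all add: W_seq_0 S_seq_Suc_W W_seq_Suc power2_eq_square algebra_simps)

lemma S_W_add:
  "S_seq (m + n) = S_seq m * W_seq n + W_seq m * S_seq n \<and>
   W_seq (m + n) = W_seq m * W_seq n + 3 * S_seq m * S_seq n"
  by (induction m) (simp_all add: W_seq_0 S_seq_Suc_W W_seq_Suc algebra_simps)

text \<open>
  This is \<open>(1 - E)\<^bsup>2n\<^esup> = (- E)\<^sup>n (2 - \<surd>3)\<^sup>n\<close> for the shift \<open>E\<close>, where \<open>E + E\<^bsup>-1\<^esup>\<close> acts as \<open>\<surd>3\<close>.
\<close>

lemma funpow_two_shift_even:
  assumes rec: "\<And>k. c (k + 2) + c (k + (-2)) = c k"
  shows "(two_shift 0 1 (-1) ^^ (2 * n)) c m =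
    (-1) ^ n * (W_seq n * c (m + int n) - S_seq n * (c (m + int n + 1) + c (m + int n - 1)))"
proof (induction n arbitrary: m)
  case 0
  then show ?case by (simp add: W_seq_0)
next
  case (Suc n)
  let ?q = "m + int n"
  have "(two_shift 0 1 (-1) ^^ (2 * Suc n)) c m =
      (two_shift 0 1 (-1) ^^ (2 * n)) c m - 2 * (two_shift 0 1 (-1) ^^ (2 * n)) c (m + 1)
      + (two_shift 0 1 (-1) ^^ (2 * n)) c (m + 2)"
    by (simp add: two_shift_def algebra_simps)
  also have "\<dots> = (-1) ^ n *
    (W_seq n * (c ?q - 2 * c (?q + 1) + c (?q + 2))
     - S_seq n * (c (?q + 1) + c (?q - 1) - 2 * (c (?q + 2) + c ?q) + c (?q + 3) + c (?q + 1)))"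
    unfolding Suc by (simp add: algebra_simps)
  \<comment> \<open>This cancels the values at q + 3 and leaves those at q, q + 1 and q + 2, centred
    at q + 1 as the case \<open>Suc n\<close> requires.\<close>
  also have "c (?q - 1) = c (?q + 1) - c (?q + 3)"
    using rec[of "?q + 1"] by (simp add: algebra_simps)
  finally show ?case
    by (simp add: S_seq_Suc_W W_seq_Suc algebra_simps)
qed

section \<open>The half trace of (1 - zeta)^p modulo p^2\<close>

text \<open>The missing residues are those congruent to 1 modulo 3, for which 3 would divide p = 2 n
  + 1.\<close>

lemma prime_half_mod_12:
  assumes "prime (p::nat)" "p > 3"
  shows "(p - 1) div 2 mod 12 \<in> {0, 2, 3, 5, 6, 8, 9, 11}"
proof -
  define n where "n = (p - 1) div 2"
  have p: "p = Suc (2 * n)"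
    unfolding n_def using assms by (intro odd_prime_half) auto
  then have "p = Suc (2 * (n mod 12)) + 3 * (8 * (n div 12))"
    by presburger
  moreover have "\<not> 3 dvd p"
    using assms by (auto simp: prime_nat_iff)
  ultimately have "\<not> 3 dvd Suc (2 * (n mod 12))"
    by (metis dvd_add dvd_triv_left)
  moreover have "n mod 12 < 12"
    by simp
  then have "n mod 12 \<in> {0, 1, 2, 3, 4, 5, 6, 7, 8, 9, 10, 11}"
    by (simp only: insert_iff empty_iff) presburger
  ultimately show ?thesis
    unfolding n_def[symmetric] by (elim insertE emptyE) simp_all
qed

text \<open>The index (p - (3/p)) / 2 of the theorem, with the symbol in a periodic form that case
  analysis on residues can evaluate.\<close>

definition half_index :: "nat \<Rightarrow> nat" where
  "half_index p = nat ((int p - chi12 (int p)) div 2)"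

text \<open>Write (1 - E)^p = (1 - E)^(2 n) (1 - E) and apply \<open>funpow_two_shift_even\<close>.
  The signs and the coefficients of W_n and S_n depend only on n mod 12, and the eight admissible
  residues are checked.\<close>

lemma ram12_difference_cases:
  fixes p :: nat
  defines "n \<equiv> (p - 1) div 2"
  assumes "prime (p::nat)" "p > 3"
  obtains "chi12 (int p) = 1" "half_index p = n"
      "((-1) ^ n * psi8 (int p)) * ((-1) ^ n * psi8 (int p)) = 1"
      "(two_shift 0 1 (-1) ^^ p) ram12 0 = (-1) ^ n * psi8 (int p) * (2 * W_seq n + 3 * S_seq n)"
    | "chi12 (int p) = -1" "half_index p = Suc n"
      "((-1) ^ n * psi8 (int p)) * ((-1) ^ n * psi8 (int p)) = 1"
      "(two_shift 0 1 (-1) ^^ p) ram12 0 = - ((-1) ^ n * psi8 (int p)) * W_seq n"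
proof -
  define q r where "q = n div 12" and "r = n mod 12"
  have n: "n = 12 * q + r"
    by (simp add: q_def r_def)
  have r: "r \<in> {0, 2, 3, 5, 6, 8, 9, 11}"
    unfolding r_def n_def by (rule prime_half_mod_12[OF assms(2,3)])
  have p: "p = Suc (2 * n)"
    unfolding n_def using assms by (intro odd_prime_half) auto
  have "int p = 2 * int r + 1 + 12 * (2 * int q)" "int p = 2 * int r + 1 + 8 * (3 * int q)"
    by (simp_all add: p n)
  then have "int p mod 12 = (2 * int r + 1) mod 12" "int p mod 8 = (2 * int r + 1) mod 8"
    by (metis mod_mult_self2)+
  then have chi: "chi12 (int p) = chi12 (2 * int r + 1)" and psi: "psi8 (int p) = psi8 (2 * int r + 1)"
    by (simp_all only: chi12_def psi8_def)
  have ram: "ram12 (int n + j) = ram12 (int r + j)" for j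
    unfolding ram12_add_mod[of "int n"] ram12_add_mod[of "int r"] by (simp add: r_def zmod_int)
  have sgn: "(-1::int) ^ n = (-1) ^ r"
    by (simp add: n power_add)
  have "(two_shift 0 1 (-1) ^^ p) ram12 0 =
      (two_shift 0 1 (-1) ^^ (2 * n)) ram12 0 - (two_shift 0 1 (-1) ^^ (2 * n)) ram12 1"
    by (simp add: p two_shift_def[of _ _ _ "(two_shift 0 1 (-1) ^^ (2 * n)) ram12"])
  also have "\<dots> = (-1) ^ r * (W_seq n * (ram12 (int n + 0) - ram12 (int n + 1))
      - S_seq n * (ram12 (int n + 1) + ram12 (int n + (-1)) - ram12 (int n + 2) - ram12 (int n + 0)))"
    unfolding funpow_two_shift_even[of ram12, OF ram12_rec] sgn by (simp add: algebra_simps)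
  finally have t: "(two_shift 0 1 (-1) ^^ p) ram12 0 =
      (-1) ^ r * (W_seq n * (ram12 (int r + 0) - ram12 (int r + 1))
      - S_seq n * (ram12 (int r + 1) + ram12 (int r + (-1)) - ram12 (int r + 2) - ram12 (int r + 0)))"
    unfolding ram .
  have h: "half_index p = (if chi12 (int p) = 1 then n else Suc n)" if "chi12 (int p) = 1 \<or> chi12 (int p) = -1"
    using that by (auto simp: half_index_def p)
  let ?e = "(-1) ^ n * psi8 (int p)" and ?t = "(two_shift 0 1 (-1) ^^ p) ram12 0"
  have "?e * ?e = 1 \<and> (chi12 (int p) = 1 \<and> ?t = ?e * (2 * W_seq n + 3 * S_seq n)
      \<or> chi12 (int p) = -1 \<and> ?t = - ?e * W_seq n)"
    unfolding t sgn chi psi using r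
    by (elim insertE emptyE) (simp_all add: chi12_def psi8_def ram12_def algebra_simps)
  then show ?thesis
    using that h by fastforce
qed

text \<open>(1 - E)^(2 p) is evaluated on \<open>chi12\<close> twice: as (1 - E^p)^2 by Frobenius,
  and by \<open>funpow_two_shift_even\<close>. The remaining coefficient of S_p is 1 or 2 up to
  sign, according to p mod 12.\<close>

lemma S_seq_prime_cong:
  assumes "prime (p::nat)" "p > 3"
  shows "[S_seq p = chi12 (int p)] (mod int p)"
proof -
  let ?T = "two_shift 0 1 (-1)"
  have odd: "odd p"
    using assms by (simp add: prime_odd_nat)
  have neg: "(-1::int) ^ p = -1"
    using odd by simp
  have frob: "[(?T ^^ p) c m = c m - c (m + int p)] (mod int p)" for c m
    using two_shift_frobenius[OF assms(1), of 0 1 "-1" c m] by (simp add: neg)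
  have "(?T ^^ (2 * p)) chi12 1 = (?T ^^ p) ((?T ^^ p) chi12) 1"
    by (simp add: mult_2 funpow_add)
  moreover have "[(?T ^^ p) ((?T ^^ p) chi12) 1 = (?T ^^ p) chi12 1 - (?T ^^ p) chi12 (1 + int p)] (mod int p)"
    by (rule frob)
  moreover have "[(?T ^^ p) chi12 1 - (?T ^^ p) chi12 (1 + int p) =
      (chi12 1 - chi12 (1 + int p)) - (chi12 (1 + int p) - chi12 (1 + int p + int p))] (mod int p)"
    by (intro cong_diff frob)
  ultimately have "[(?T ^^ (2 * p)) chi12 1 =
      (chi12 1 - chi12 (1 + int p)) - (chi12 (1 + int p) - chi12 (1 + int p + int p))] (mod int p)"
    by (simp only: cong_trans)
  moreover have "(?T ^^ (2 * p)) chi12 1 =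
      - (W_seq p * chi12 (1 + int p) - S_seq p * (chi12 (2 + int p) + chi12 (int p)))"
    by (subst funpow_two_shift_even[of chi12, OF chi12_rec]) (simp add: neg algebra_simps)
  \<comment> \<open>The evaluation point 1 puts the centre at the even number 1 + p, so W_p drops
    out.\<close>
  moreover have even: "chi12 (1 + int p) = 0"
    using odd unfolding chi12_def by (simp, presburger)
  moreover have "chi12 1 = 1"
    by (simp add: chi12_def)
  ultimately have *: "[S_seq p * (chi12 (2 + int p) + chi12 (int p)) = 1 + chi12 (1 + 2 * int p)] (mod int p)"
    by (simp add: algebra_simps)
  have "\<not> 3 dvd p"
    using assms by (auto simp: prime_nat_iff)
  then have "int p mod 12 \<in> {1, 5, 7, 11}"
    using odd by (simp, presburger)
  have m: "(2 + int p) mod 12 = (2 + int p mod 12) mod 12"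
    "(1 + 2 * int p) mod 12 = (1 + 2 * (int p mod 12)) mod 12"
    by (metis mod_add_right_eq mod_mult_right_eq)+
  from \<open>int p mod 12 \<in> {1, 5, 7, 11}\<close>
  consider "int p mod 12 = 1" | "int p mod 12 = 5" | "int p mod 12 = 7" | "int p mod 12 = 11"
    by auto
  then show ?thesis
  proof cases
    case 1
    then have "(2 + int p) mod 12 = 3" "(1 + 2 * int p) mod 12 = 3"
      unfolding m by simp_all
    with 1 have "chi12 (int p) = 1" "chi12 (2 + int p) = 0" "chi12 (1 + 2 * int p) = 0"
      by (simp_all add: chi12_def)
    with * show ?thesis by simp
  next
    case 2
    then have "(2 + int p) mod 12 = 7" "(1 + 2 * int p) mod 12 = 11"
      unfolding m by simp_all
    with 2 have c: "chi12 (int p) = - 1" "chi12 (2 + int p) = - 1" "chi12 (1 + 2 * int p) = 1"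
      by (simp_all add: chi12_def)
    have "[2 * S_seq p = 2 * (-1)] (mod int p)"
      using * cong_minus_minus_iff[of "2 * S_seq p" "-2" "int p"] unfolding c by (simp add: mult.commute)
    with assms show ?thesis
      unfolding c by (rule_tac cong_mult_2_cancel) simp_all
  next
    case 3
    then have "(2 + int p) mod 12 = 9" "(1 + 2 * int p) mod 12 = 3"
      unfolding m by simp_all
    with 3 have c: "chi12 (int p) = - 1" "chi12 (2 + int p) = 0" "chi12 (1 + 2 * int p) = 0"
      by (simp_all add: chi12_def)
    show ?thesis
      using * cong_minus_minus_iff[of "S_seq p" "-1" "int p"] unfolding c by simp
  next
    case 4
    then have "(2 + int p) mod 12 = 1" "(1 + 2 * int p) mod 12 = 11"
      unfolding m by simp_all
    with 4 have c: "chi12 (int p) = 1" "chi12 (2 + int p) = 1" "chi12 (1 + 2 * int p) = 1"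
      by (simp_all add: chi12_def)
    have "[2 * S_seq p = 2 * 1] (mod int p)"
      using * unfolding c by (simp add: mult.commute)
    with assms show ?thesis
      unfolding c by (rule_tac cong_mult_2_cancel) simp_all
  qed
qed

text \<open>Let N be \<open>half_index p\<close> and t the half trace. Then S_p - \<chi> = 2 s S_N t
  with a sign s. As t is 2 modulo p, this forces p to divide S_N. Now W_N is s modulo p, the Pell
  equation lifts this to p^2, and t - 2 becomes 3 s \<chi> S_N.\<close>

lemma ram12_difference_cong_S_seq:
  assumes "prime (p::nat)" "p > 3"
  shows "int p dvd S_seq (half_index p)"
    and "[(-1) ^ ((p - 1) div 2) * ((two_shift 0 1 (-1) ^^ p) ram12 0 - 2) =
      3 * psi8 (int p) * S_seq (half_index p)] (mod (int p)\<^sup>2)"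
proof -
  define n where "n = (p - 1) div 2"
  define N where "N = half_index p"
  define \<chi> where "\<chi> = chi12 (int p)"
  define t where "t = (two_shift 0 1 (-1) ^^ p) ram12 0"
  define s where "s = \<chi> * ((-1) ^ n * psi8 (int p))"
  have p: "p = Suc (2 * n)"
    unfolding n_def using assms by (intro odd_prime_half) auto
  have odd: "odd p"
    using p by simp
  \<comment> \<open>Passing from n to N, which is n or n + 1 according to \<chi>, merges the two
    cases into one formula.\<close>
  have ss: "s * s = 1" and \<chi>\<chi>: "\<chi> * \<chi> = 1"
    and t_eq: "t = s * (2 * W_seq N + 3 * \<chi> * S_seq N)"
    and S_eq: "S_seq p - \<chi> = 2 * S_seq N * (2 * W_seq N + 3 * \<chi> * S_seq N)"
  proof -
    have "p = Suc (n + n)"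
      using p by simp
    then have S_p: "S_seq p = 4 * S_seq n * W_seq n + (W_seq n)\<^sup>2 + 3 * (S_seq n)\<^sup>2"
      using S_W_add[of n n] by (simp add: S_seq_Suc_W power2_eq_square)
    have "s * s = 1 \<and> \<chi> * \<chi> = 1 \<and> t = s * (2 * W_seq N + 3 * \<chi> * S_seq N) \<and>
      S_seq p - \<chi> = 2 * S_seq N * (2 * W_seq N + 3 * \<chi> * S_seq N)"
    proof (cases rule: ram12_difference_cases[OF assms])
      case 1
      note 1 = 1[folded n_def N_def \<chi>_def t_def]
      show ?thesis
        using W_S_pell[of n] S_p 1(3) unfolding s_def 1(1,2,4)
        by (simp add: power2_eq_square algebra_simps)
    next
      case 2
      note 2 = 2[folded n_def N_def \<chi>_def t_def]
      show ?thesis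
        using W_S_pell[of n] S_p 2(3) unfolding s_def 2(1,2,4)
        by (simp add: S_seq_Suc_W W_seq_Suc power2_eq_square algebra_simps)
    qed
    then show "s * s = 1" "\<chi> * \<chi> = 1" "t = s * (2 * W_seq N + 3 * \<chi> * S_seq N)"
      "S_seq p - \<chi> = 2 * S_seq N * (2 * W_seq N + 3 * \<chi> * S_seq N)" by auto
  qed
  have pr: "prime (int p)"
    using assms by simp
  have p_ndvd: "\<not> int p dvd 2 * k" if "k * k = 1" for k :: int
  proof
    assume "int p dvd 2 * k"
    then have "int p dvd 2 * k * k" by simp
    with that have "int p dvd 2" by (simp add: mult.assoc)
    with assms(2) show False using zdvd_imp_le by fastforce
  qed
  have "ram12 (int p) = 0"
    using odd unfolding ram12_def by (simp, presburger)
  then have t2: "[t = 2] (mod int p)"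
    using two_shift_frobenius[OF assms(1), of 0 1 "-1" ram12 0]
    by (simp add: t_def ram12_def[of 0])
  have "S_seq p - \<chi> = 2 * s * S_seq N * t"
    using ss unfolding S_eq t_eq by (simp add: algebra_simps) (metis mult.assoc mult.commute mult_1)
  then have "int p dvd 2 * s * S_seq N * t"
    using S_seq_prime_cong[OF assms] by (simp add: cong_iff_dvd_diff \<chi>_def)
  moreover have "\<not> int p dvd t"
    using t2 p_ndvd[of 1] by (simp add: cong_dvd_iff)
  ultimately have pS: "int p dvd S_seq N"
    using pr p_ndvd[OF ss] by (simp add: prime_dvd_mult_iff)
  then show "int p dvd S_seq (half_index p)"
    by (simp add: N_def)
  let ?W = "W_seq N"
  have "t - 2 = 2 * s * (?W - s) + s * 3 * \<chi> * S_seq N"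
    using ss unfolding t_eq by (simp add: algebra_simps)
  moreover have "int p dvd t - 2"
    using t2 by (simp add: cong_iff_dvd_diff)
  ultimately have "int p dvd 2 * s * (?W - s)"
    using pS by (simp add: dvd_add_left_iff)
  then have pW: "int p dvd ?W - s"
    using pr p_ndvd[OF ss] by (simp add: prime_dvd_mult_iff)
  \<comment> \<open>In (W - s) (W + s) = 3 S_N^2 the second factor is prime to p, so p^2 divides the
    first.\<close>
  have "\<not> int p dvd ?W + s"
  proof
    assume "int p dvd ?W + s"
    then have "int p dvd (?W + s) - (?W - s)" using pW by (rule dvd_diff)
    with p_ndvd[OF ss] show False by simp
  qed
  then have "coprime ((int p)\<^sup>2) (?W + s)"
    using pr by (simp add: prime_imp_coprime)
  moreover have "(?W - s) * (?W + s) = 3 * (S_seq N)\<^sup>2"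
    using W_S_pell[of N] ss by (simp add: algebra_simps power2_eq_square)
  then have "(int p)\<^sup>2 dvd (?W - s) * (?W + s)"
    using pS by simp
  ultimately have "(int p)\<^sup>2 dvd ?W - s"
    by (simp add: coprime_dvd_mult_left_iff)
  then have "(int p)\<^sup>2 dvd (-1) ^ n * (2 * s * (?W - s))"
    by simp
  moreover have "(-1) ^ n * (t - 2) - 3 * psi8 (int p) * S_seq N = (-1) ^ n * (2 * s * (?W - s))"
  proof -
    have "(-1) ^ n * s * \<chi> = psi8 (int p)"
      using \<chi>\<chi> by (simp add: s_def algebra_simps flip: power_mult_distrib)
    moreover have "(-1) ^ n * (t - 2) = (-1) ^ n * (2 * s * (?W - s)) + 3 * ((-1) ^ n * s * \<chi>) * S_seq N"
      unfolding \<open>t - 2 = 2 * s * (?W - s) + s * 3 * \<chi> * S_seq N\<close> by (simp add: algebra_simps)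
    ultimately show ?thesis by simp
  qed
  ultimately show "[(-1) ^ ((p - 1) div 2) * ((two_shift 0 1 (-1) ^^ p) ram12 0 - 2) =
      3 * psi8 (int p) * S_seq (half_index p)] (mod (int p)\<^sup>2)"
    by (simp only: cong_iff_dvd_diff flip: n_def t_def N_def)
qed

section \<open>Sums of trinomial coefficients\<close>

text \<open>By symmetry this is \<open>trinomial_prime_row_cong\<close> at m = p - d; as p divides
  the coefficient, the multiplier p - d may be replaced by -d modulo p^2.\<close>

lemma trinomial_prime_cong:
  assumes "prime (p::nat)" "0 < d" "d < p"
  shows "[int d * trinomial p (int d) = (if 3 dvd int p - int d then 2 else - 1) * int p] (mod (int p)\<^sup>2)"
proof -
  have m: "int (p - d) = int p - int d"
    using assms by simp
  have tri: "trinomial p (int (p - d) - int p) = trinomial p (int d)"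
    using trinomial_uminus[of p "int d"] by (simp add: m)
  have dvd: "3 dvd p - d \<longleftrightarrow> 3 dvd int p - int d"
    using int_dvd_int_iff[of 3 "p - d"] by (simp add: m)
  have "int p dvd trinomial p (int d)"
    using trinomial_prime_row_dvd[of p "p - d"] assms unfolding tri by simp
  then have "[int p * trinomial p (int d) = 0] (mod (int p)\<^sup>2)"
    by (simp add: cong_0_iff power2_eq_square)
  moreover have "[(int p - int d) * trinomial p (int d) =
      (if 3 dvd int p - int d then - 2 else 1) * int p] (mod (int p)\<^sup>2)"
    using trinomial_prime_row_cong[of p "p - d"] assms unfolding tri dvd unfolding m by simp
  ultimately have "[int p * trinomial p (int d) - (int p - int d) * trinomial p (int d) =
      0 - (if 3 dvd int p - int d then - 2 else 1) * int p] (mod (int p)\<^sup>2)"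
    by (rule cong_diff)
  then show ?thesis
    by (simp add: algebra_simps split: if_splits)
qed

definition tri_sum :: "nat \<Rightarrow> int \<Rightarrow> int" where
  "tri_sum n d = (\<Sum>k<n. trinomial k d)"

lemma tri_sum_rec: "tri_sum n (d - 1) + tri_sum n (d + 1) = trinomial n d - trinomial 0 d"
  unfolding tri_sum_def by (rule sum_trinomial_shift)

text \<open>The recurrence at odd arguments links even ones in steps of two; its correction
  \<open>trinomial 0 d\<close> is nonzero only at d = 0 and never enters.\<close>

lemma tri_sum_even:
  "(-1) ^ j * tri_sum n (2 * int j) =
     tri_sum n 0 - (\<Sum>i<j. (-1) ^ i * trinomial n (2 * int i + 1))"
proof (induction j)
  case (Suc j)
  have step: "tri_sum n (2 * int (Suc j)) = trinomial n (2 * int j + 1) - tri_sum n (2 * int j)"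
    using tri_sum_rec[of n "2 * int j + 1"] by (simp add: trinomial_0 algebra_simps)
  show ?case
    unfolding step using Suc by (simp add: algebra_simps)
qed simp

lemma tri_sum_odd:
  "(-1) ^ j * tri_sum n (2 * int j + 1) =
     tri_sum n 1 + (\<Sum>i = 1..j. (-1) ^ i * trinomial n (2 * int i))"
proof (induction j)
  case (Suc j)
  have step: "tri_sum n (2 * int (Suc j) + 1) = trinomial n (2 * int (Suc j)) - tri_sum n (2 * int j + 1)"
    using tri_sum_rec[of n "2 * int (Suc j)"] by (simp add: trinomial_0 algebra_simps)
  show ?case
    unfolding step using Suc by (simp add: algebra_simps)
qed simp

text \<open>At d = 0 the two neighbours agree by symmetry, so the recurrence determines the
  value.\<close>

lemma tri_sum_1: "2 * tri_sum n 1 = trinomial n 0 - 1"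
  using tri_sum_rec[of n 0] trinomial_uminus[of _ 1] by (simp add: tri_sum_def trinomial_0)

lemma tri_sum_last:
  assumes "n > 1"
  shows "tri_sum n (int n - 1) = 1"
proof -
  have "tri_sum n (int n + 1) = 0"
    unfolding tri_sum_def by (intro sum.neutral) (auto intro: trinomial_eq_0)
  then show ?thesis
    using tri_sum_rec[of n "int n"] assms by (simp add: trinomial_self trinomial_0)
qed

lemma sum_atMost_odd: "(\<Sum>k\<le>Suc (2 * n). f k) = (\<Sum>r\<le>n. f (2 * r) + f (Suc (2 * r)) :: int)"
  by (induction n) (simp_all add: add.assoc)

text \<open>Up to (-1)^r this is minus the weight in \<open>trinomial_prime_row_cong\<close> at m =
  2 r, which is how the trace enters.\<close>

lemma ram12_even: "ram12 (2 * int r) = (-1) ^ r * (if 3 dvd r then 2 else - 1)"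
proof -
  define q s where "q = r div 6" and "s = r mod 6"
  have r: "r = s + 6 * q"
    by (simp add: q_def s_def)
  have "s < 6"
    by (simp add: s_def)
  then have "s \<in> {0, 1, 2, 3, 4, 5}"
    by (simp only: insert_iff empty_iff) presburger
  moreover have "(2 * int r) mod 12 = (2 * int s + 12 * int q) mod 12"
    by (simp add: r algebra_simps)
  then have "(2 * int r) mod 12 = (2 * int s) mod 12"
    unfolding mod_mult_self2 .
  then have "ram12 (2 * int r) = ram12 (2 * int s)"
    by (simp only: ram12_def)
  moreover have "3 dvd r \<longleftrightarrow> 3 dvd s"
    using dvd_add_left_iff[of 3 "3 * (2 * q)" s] by (simp add: r)
  moreover have "(-1::int) ^ r = (-1) ^ s"
    by (simp add: r power_add power_mult)
  ultimately show ?thesis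
    by (elim insertE emptyE) (simp_all add: ram12_def)
qed

text \<open>Telescoping from F (p - 1) = 1 leaves a signed sum over row p. Its entries at p - 2 r
  and the C(p, 2 r) are proportional modulo p^2, so the sum becomes that of C(p, 2 r) *
  \<open>ram12 (2 * int r)\<close>, the even terms of (1 - E)^p at 0.\<close>

lemma tri_sum_0_cong:
  assumes "prime (p::nat)" "p > 3"
  shows "[tri_sum p 0 - (-1) ^ ((p - 1) div 2) =
    (-1) ^ ((p - 1) div 2) * ((two_shift 0 1 (-1) ^^ p) ram12 0 - 2)] (mod (int p)\<^sup>2)"
proof -
  define n where "n = (p - 1) div 2"
  have p: "p = Suc (2 * n)"
    unfolding n_def using assms by (intro odd_prime_half) auto
  have row: "[(-1) ^ (n - r) * trinomial p (int (2 * r) - int p) =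
      (-1) ^ n * (int (p choose (2 * r)) * ram12 (2 * int r))] (mod (int p)\<^sup>2)"
    if r: "r \<in> {1..n}" for r
  proof -
    let ?h = "trinomial p (int (2 * r) - int p)" and ?C = "int (p choose (2 * r))"
    let ?w = "if 3 dvd r then 2 else - 1 :: int"
    have m: "0 < 2 * r" "2 * r < p"
      using r by (auto simp: p)
    have 3: "3 dvd 2 * r \<longleftrightarrow> 3 dvd r"
      by presburger
    have "[int (2 * r) * ?h = - ?w * int p] (mod (int p)\<^sup>2)"
      using trinomial_prime_row_cong[OF assms(1) m] unfolding 3 by (simp split: if_splits)
    moreover have "[?w * (int (2 * r) * ((-1) ^ (2 * r) * ?C)) = ?w * - int p] (mod (int p)\<^sup>2)"
      by (intro cong_mult choose_prime_cong_mod_prime_sq assms m cong_refl)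
    ultimately have "[int (2 * r) * ?h = int (2 * r) * (?w * ?C)] (mod (int p)\<^sup>2)"
      by (simp add: cong_def algebra_simps)
    moreover have "coprime (int (2 * r)) ((int p)\<^sup>2)"
      using m assms(1) by (simp only: coprime_power_right_iff coprime_int_iff)
        (metis coprime_commute nat_dvd_not_less prime_imp_coprime_nat)
    ultimately have "[?h = ?w * ?C] (mod (int p)\<^sup>2)"
      using cong_mult_lcancel by blast
    then have "[(-1) ^ (n - r) * ?h = (-1) ^ (n - r) * (?w * ?C)] (mod (int p)\<^sup>2)"
      by (intro cong_mult cong_refl)
    moreover have "(-1::int) ^ (n - r) = (-1) ^ n * (-1) ^ r"
      using r by (simp add: minus_one_power_iff)
    ultimately show ?thesis
      unfolding ram12_even by (simp add: algebra_simps)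
  qed
  have "tri_sum p (2 * int n) = 1"
    using tri_sum_last[of p] assms by (simp add: p)
  then have "tri_sum p 0 - (-1) ^ n = (\<Sum>i<n. (-1) ^ i * trinomial p (2 * int i + 1))"
    using tri_sum_even[of n p] by simp
  \<comment> \<open>Substituting i = n - r turns 2 i + 1 into p - 2 r.\<close>
  also have "\<dots> = (\<Sum>r = 1..n. (-1) ^ (n - r) * trinomial p (int (2 * r) - int p))"
  proof (rule sum.reindex_bij_witness[of _ "\<lambda>r. n - r" "\<lambda>i. n - i"])
    fix i assume "i \<in> {..<n}"
    then have eq: "int (2 * (n - i)) - int p = - (2 * int i + 1)"
      by (simp add: p of_nat_diff)
    from \<open>i \<in> {..<n}\<close> show "(-1) ^ (n - (n - i)) * trinomial p (int (2 * (n - i)) - int p) =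
        (-1) ^ i * trinomial p (2 * int i + 1)"
      unfolding eq trinomial_uminus by simp
  qed auto
  finally have 1: "[tri_sum p 0 - (-1) ^ n =
      (\<Sum>r = 1..n. (-1) ^ n * (int (p choose (2 * r)) * ram12 (2 * int r)))] (mod (int p)\<^sup>2)"
    by (simp only:) (intro cong_sum row)
  have odd: "ram12 (2 * int r + 1) = 0" for r
    unfolding ram12_def by (simp, presburger)
  have "(two_shift 0 1 (-1) ^^ p) ram12 0 = (\<Sum>k\<le>p. int (p choose k) * ((-1) ^ k * ram12 (int k)))"
    unfolding two_shift_funpow by simp
  also have "\<dots> = (\<Sum>r\<le>n. int (p choose (2 * r)) * ram12 (2 * int r))"
    unfolding p sum_atMost_odd using odd by (simp add: algebra_simps)
  \<comment> \<open>The term r = 0 is the 2 subtracted in the statement.\<close>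
  also have "\<dots> = 2 + (\<Sum>r = 1..n. int (p choose (2 * r)) * ram12 (2 * int r))"
    by (simp add: atMost_atLeast0 sum.atLeast_Suc_atMost ram12_def[of 0])
  finally show ?thesis
    using 1 unfolding n_def[symmetric] by (simp add: sum_distrib_left)
qed

section \<open>Congruences between rationals\<close>

text \<open>The reduced denominator d divides every denominator b, since n b = a d with n and d
  coprime.\<close>

lemma p_integralI:
  assumes "x = of_int a / of_int b" "coprime b (int p)" "b \<noteq> 0"
  shows "p_integral p x"
proof -
  obtain n d where q: "quotient_of x = (n, d)"
    by force
  have d: "d > 0" "coprime n d" "x = of_int n / of_int d"
    using quotient_of_denom_pos[OF q] quotient_of_coprime[OF q] quotient_of_div[OF q] by auto
  have "of_int n * of_int b = (of_int a * of_int d :: rat)"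
    using d assms by (simp add: field_simps)
  then have "n * b = a * d"
    by (metis of_int_eq_iff of_int_mult)
  then have "d dvd n * b"
    by simp
  then have "d dvd b"
    using d(2) by (simp add: coprime_dvd_mult_right_iff coprime_commute)
  then have "coprime d (int p)"
    using assms(2) by (meson coprime_divisors dvd_refl)
  then show ?thesis
    by (simp add: p_integral_def q)
qed

lemma p_integralE:
  assumes "p_integral p x"
  obtains a b where "x = of_int a / of_int b" "coprime b (int p)" "b \<noteq> 0"
proof -
  obtain n d where q: "quotient_of x = (n, d)"
    by force
  show ?thesis
    using that[of n d] assms quotient_of_denom_pos[OF q] quotient_of_div[OF q]
    unfolding p_integral_def q by simp
qed

lemma p_integral_of_int: "p_integral p (of_int a)"
  by (rule p_integralI[of _ a 1]) auto

lemma p_integral_add: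
  assumes "p_integral p x" "p_integral p y"
  shows "p_integral p (x + y)"
proof -
  obtain a b where 1: "x = of_int a / of_int b" "coprime b (int p)" "b \<noteq> 0"
    using assms(1) by (rule p_integralE)
  obtain c d where 2: "y = of_int c / of_int d" "coprime d (int p)" "d \<noteq> 0"
    using assms(2) by (rule p_integralE)
  show ?thesis
    using 1 2 by (intro p_integralI[of _ "a * d + c * b" "b * d"]) (auto simp: field_simps)
qed

lemma p_integral_mult:
  assumes "p_integral p x" "p_integral p y"
  shows "p_integral p (x * y)"
proof -
  obtain a b where 1: "x = of_int a / of_int b" "coprime b (int p)" "b \<noteq> 0"
    using assms(1) by (rule p_integralE)
  obtain c d where 2: "y = of_int c / of_int d" "coprime d (int p)" "d \<noteq> 0"
    using assms(2) by (rule p_integralE)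
  show ?thesis
    using 1 2 by (intro p_integralI[of _ "a * c" "b * d"]) auto
qed

lemma rat_cong_add:
  assumes "rat_cong p a b" "rat_cong p c d"
  shows "rat_cong p (a + c) (b + d)"
proof -
  have "(a + c - (b + d)) / of_nat p = (a - b) / of_nat p + (c - d) / of_nat p"
    by (simp add: diff_divide_distrib add_divide_distrib)
  then show ?thesis
    using assms by (simp add: rat_cong_def p_integral_add)
qed

lemma rat_cong_of_int_mult:
  assumes "rat_cong p a b"
  shows "rat_cong p (of_int c * a) (of_int c * b)"
proof -
  have eq: "(of_int c * a - of_int c * b) / of_nat p = of_int c * ((a - b) / of_nat p)"
    by (simp add: right_diff_distrib)
  show ?thesis
    using assms unfolding rat_cong_def eq by (intro conjI p_integral_mult p_integral_of_int) simp_all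
qed

lemma rat_cong_sum:
  assumes "\<And>i. i \<in> I \<Longrightarrow> rat_cong p (f i) (g i)"
  shows "rat_cong p (sum f I) (sum g I)"
  using assms
proof (induction I rule: infinite_finite_induct)
  case (insert i I)
  then show ?case by (simp add: rat_cong_add)
\<comment> \<open>Empty and infinite index sets remain; both sums are then 0.\<close>
qed (auto simp: rat_cong_def p_integral_of_int[where a = 0, simplified])

text \<open>The bridge from the integers: division by k p turns a congruence modulo p^2 into one
  modulo p. The hypothesis also yields that p divides k a, hence a, so a / p is integral.\<close>

lemma rat_cong_divide_primeI:
  assumes "prime p" "coprime k (int p)" "k \<noteq> 0" "[k * a = b * int p] (mod (int p)\<^sup>2)"
  shows "rat_cong p (of_int a / of_nat p) (of_int b / of_int k)"
proof -
  have p0: "p > 0"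
    using assms(1) by (simp add: prime_gt_0_nat)
  obtain z where z: "k * a - b * int p = (int p)\<^sup>2 * z"
    using assms(4) by (auto simp: cong_iff_dvd_diff)
  then have "k * a = int p * (b + int p * z)"
    by (simp add: power2_eq_square algebra_simps)
  then have "int p dvd a"
    using assms(2) by (metis coprime_commute coprime_dvd_mult_right_iff dvd_triv_left)
  then obtain a' where a': "a = int p * a'" ..
  have "p_integral p (of_int a / of_nat p)"
    using p0 by (intro p_integralI[of _ a' 1]) (auto simp: a')
  moreover have "p_integral p (of_int b / of_int k)"
    using assms by (intro p_integralI[of _ b k]) auto
  moreover have "(of_int a / of_nat p - of_int b / of_int k) / of_nat p =
      (of_int (k * a - b * int p) / of_nat p ^ 2 / of_int k :: rat)"
    using p0 assms(3) by (simp add: field_simps power2_eq_square)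
  then have "(of_int a / of_nat p - of_int b / of_int k) / of_nat p = (of_int z / of_int k :: rat)"
    unfolding z using p0 by simp
  then have "p_integral p ((of_int a / of_nat p - of_int b / of_int k) / of_nat p)"
    using assms by (intro p_integralI[of _ z k]) auto
  ultimately show ?thesis
    by (simp add: rat_cong_def)
qed

lemma rat_cong_trinomial_prime:
  assumes "prime p" "0 < d" "d < p"
  shows "rat_cong p (of_int (trinomial p (int d)) / of_nat p)
    ((if 3 dvd int p - int d then 2 else - 1) / of_nat d)"
proof -
  have "coprime (int d) (int p)"
    using assms by (metis coprime_commute coprime_int_iff nat_dvd_not_less prime_imp_coprime_nat)
  then have "rat_cong p (of_int (trinomial p (int d)) / of_nat p)
    (of_int (if 3 dvd int p - int d then 2 else - 1) / of_int (int d))"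
    using assms by (intro rat_cong_divide_primeI trinomial_prime_cong) auto
  then show ?thesis
    by (simp split: if_splits)
qed

lemma rat_cong_tri_sum_1:
  assumes "prime (p::nat)" "p > 3"
  shows "rat_cong p (of_int (tri_sum p 1) / of_nat p) 0"
proof -
  have "[2 * tri_sum p 1 = 0 * int p] (mod (int p)\<^sup>2)"
    using trinomial_prime_0_cong[OF assms] by (simp add: tri_sum_1 cong_iff_dvd_diff)
  moreover have "coprime 2 (int p)"
    using assms prime_odd_nat[of p] by simp
  ultimately show ?thesis
    using rat_cong_divide_primeI[of p 2 "tri_sum p 1" 0] assms by simp
qed

lemma rat_cong_tri_sum_0:
  assumes "prime (p::nat)" "p > 3"
  shows "rat_cong p (of_int (tri_sum p 0 - (-1) ^ ((p - 1) div 2)) / of_nat p)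
    (3 * of_int (Legendre (-2) (int p))
      * (of_int (S_seq (nat ((int p - Legendre 3 (int p)) div 2))) / of_nat p))"
proof -
  let ?a = "tri_sum p 0 - (-1) ^ ((p - 1) div 2)"
  obtain z where z: "S_seq (half_index p) = int p * z"
    using ram12_difference_cong_S_seq(1)[OF assms] ..
  have "[?a = 3 * psi8 (int p) * S_seq (half_index p)] (mod (int p)\<^sup>2)"
    using tri_sum_0_cong[OF assms] ram12_difference_cong_S_seq(2)[OF assms] by (rule cong_trans)
  then have "[1 * ?a = (3 * psi8 (int p) * z) * int p] (mod (int p)\<^sup>2)"
    by (simp add: z mult_ac)
  then have "rat_cong p (of_int ?a / of_nat p) (of_int (3 * psi8 (int p) * z) / of_int 1)"
    using assms by (intro rat_cong_divide_primeI) auto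
  moreover have "nat ((int p - Legendre 3 (int p)) div 2) = half_index p"
    using assms by (simp add: Legendre_3_eq_chi12 half_index_def)
  moreover have "Legendre (-2) (int p) = psi8 (int p)"
    using assms by (simp add: Legendre_minus_2_eq_psi8)
  ultimately show ?thesis
    using assms by (simp add: z)
qed

section \<open>The odd and the even case of the theorem\<close>

theorem theorem1p1:
  fixes p d :: nat
  assumes "prime p" and "p > 3" and "d \<le> p - 1"
  shows "(odd d \<longrightarrow>
      rat_cong p
        (1 / of_nat p * of_int (\<Sum>k = 0..p - 1. trinomial k (int d)))
        ((-1) ^ ((d + 1) div 2) / 2 *
          ((\<Sum>k = 1..(d - 1) div 2. (-1) ^ k / of_nat k)
            - 3 * (\<Sum>k | 1 \<le> k \<and> k \<le> (d - 1) div 2 \<and> 3 dvd k + p. (-1) ^ k / of_nat k)))) \<and>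
    (even d \<longrightarrow>
      rat_cong p
        (1 / of_nat p *
          of_int ((-1) ^ (d div 2) * (\<Sum>k = 0..p - 1. trinomial k (int d))
            - (-1) ^ ((p - 1) div 2)))
        (3 * of_int (Legendre (-2) (int p))
            * (of_int (S_seq (nat ((int p - Legendre 3 (int p)) div 2))) / of_nat p)
          - 2 * (\<Sum>j | j < d div 2. (-1) ^ j / of_nat (2 * j + 1))
          + 3 * (\<Sum>j | j < d div 2 \<and> \<not> 3 dvd (int p - 2 * int j - 1).
                  (-1) ^ j / of_nat (2 * j + 1))))"
proof (intro conjI impI)
  have dp: "d < p"
    using assms by linarith
  have F: "(\<Sum>k = 0..p - 1. trinomial k (int d)) = tri_sum p (int d)"
    unfolding tri_sum_def using assms(2) by (intro sum.cong) auto
  {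
    assume "odd d"
    then obtain j where d: "d = 2 * j + 1"
      by (rule oddE)
    let ?t = "\<lambda>i. of_int (trinomial p (2 * int i)) / (of_nat p :: rat)"
    let ?u = "\<lambda>i. (if 3 dvd int p - 2 * int i then 2 else - 1) / (of_nat (2 * i) :: rat)"
    have "rat_cong p (?t i) (?u i)" if "i \<in> {1..j}" for i
      using rat_cong_trinomial_prime[OF assms(1), of "2 * i"] that dp d by simp
    then have "rat_cong p
      (of_int ((-1) ^ j) * (of_int (tri_sum p 1) / of_nat p + (\<Sum>i = 1..j. of_int ((-1) ^ i) * ?t i)))
      (of_int ((-1) ^ j) * (0 + (\<Sum>i = 1..j. of_int ((-1) ^ i) * ?u i)))"
      using assms by (intro rat_cong_of_int_mult rat_cong_add rat_cong_tri_sum_1 rat_cong_sum) auto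
    moreover have "1 / of_nat p * of_int (tri_sum p (int d)) =
      of_int ((-1) ^ j) * (of_int (tri_sum p 1) / of_nat p + (\<Sum>i = 1..j. of_int ((-1) ^ i) * ?t i))"
    proof -
      have "tri_sum p (int d) = (-1) ^ j * ((-1) ^ j * tri_sum p (2 * int j + 1))"
        by (simp add: d add.commute)
      also have "\<dots> = (-1) ^ j * (tri_sum p 1 + (\<Sum>i = 1..j. (-1) ^ i * trinomial p (2 * int i)))"
        unfolding tri_sum_odd ..
      finally show ?thesis
        by (simp add: add_divide_distrib sum_divide_distrib algebra_simps)
    qed
    moreover have "(-1) ^ ((d + 1) div 2) / 2 *
          ((\<Sum>k = 1..(d - 1) div 2. (-1) ^ k / of_nat k)
            - 3 * (\<Sum>k | 1 \<le> k \<and> k \<le> (d - 1) div 2 \<and> 3 dvd k + p. (-1) ^ k / of_nat k)) =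
      (of_int ((-1) ^ j) * (0 + (\<Sum>i = 1..j. of_int ((-1) ^ i) * ?u i)) :: rat)"
    proof -
      have eq: "{k. 1 \<le> k \<and> k \<le> (d - 1) div 2 \<and> 3 dvd k + p} = {k \<in> {1..j}. 3 dvd k + p}"
        by (auto simp: d)
      \<comment> \<open>The two numbers differ by 3 k.\<close>
      have 3: "3 dvd k + p \<longleftrightarrow> 3 dvd int p - 2 * int k" for k
        by presburger
      \<comment> \<open>Each k has weight -2 or 1, minus the numerator of \<open>?u k\<close>; the
        denominator 2 k there accounts for the factor 2.\<close>
      have "(\<Sum>k = 1..j. (-1) ^ k / of_nat k) - 3 * (\<Sum>k \<in> {k \<in> {1..j}. 3 dvd k + p}. (-1) ^ k / of_nat k)
        = (\<Sum>k = 1..j. (-1) ^ k / of_nat k - 3 * (if 3 dvd k + p then (-1) ^ k / of_nat k else 0 :: rat))"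
        by (simp only: sum.inter_filter sum_subtractf sum_distrib_left finite_atLeastAtMost)
      also have "\<dots> = (\<Sum>k = 1..j. - 2 * (of_int ((-1) ^ k) * ?u k))"
        by (intro sum.cong) (auto simp: 3)
      finally show ?thesis
        unfolding eq by (simp add: d sum_distrib_left sum_negf mult.assoc)
    qed
    ultimately show "rat_cong p
        (1 / of_nat p * of_int (\<Sum>k = 0..p - 1. trinomial k (int d)))
        ((-1) ^ ((d + 1) div 2) / 2 *
          ((\<Sum>k = 1..(d - 1) div 2. (-1) ^ k / of_nat k)
            - 3 * (\<Sum>k | 1 \<le> k \<and> k \<le> (d - 1) div 2 \<and> 3 dvd k + p. (-1) ^ k / of_nat k)))"
      unfolding F by (simp only:)
  }
  {
    assume "even d"
    then obtain j where d: "d = 2 * j"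
      by (rule evenE)
    let ?t = "\<lambda>i. of_int (trinomial p (2 * int i + 1)) / (of_nat p :: rat)"
    let ?u = "\<lambda>i. (if 3 dvd int p - 2 * int i - 1 then 2 else - 1) / (of_nat (2 * i + 1) :: rat)"
    let ?a = "tri_sum p 0 - (-1) ^ ((p - 1) div 2)"
    let ?b = "3 * of_int (Legendre (-2) (int p))
      * (of_int (S_seq (nat ((int p - Legendre 3 (int p)) div 2))) / of_nat p) :: rat"
    have "rat_cong p (?t i) (?u i)" if "i \<in> {..<j}" for i
      using rat_cong_trinomial_prime[OF assms(1), of "2 * i + 1"] that dp d
      by (simp add: algebra_simps)
    then have "rat_cong p
      (of_int ?a / of_nat p + of_int (- 1) * (\<Sum>i<j. of_int ((-1) ^ i) * ?t i))
      (?b + of_int (- 1) * (\<Sum>i<j. of_int ((-1) ^ i) * ?u i))"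
      using assms by (intro rat_cong_of_int_mult rat_cong_add rat_cong_tri_sum_0 rat_cong_sum) auto
    moreover have F_even: "(-1) ^ (d div 2) * tri_sum p (int d) =
        tri_sum p 0 - (\<Sum>i<j. (-1) ^ i * trinomial p (2 * int i + 1))"
      using tri_sum_even[of j p] by (simp add: d)
    have "1 / of_nat p * of_int ((-1) ^ (d div 2) * tri_sum p (int d) - (-1) ^ ((p - 1) div 2)) =
      of_int ?a / of_nat p + of_int (- 1) * (\<Sum>i<j. of_int ((-1) ^ i) * ?t i)"
      unfolding F_even
      by (simp add: add_divide_distrib diff_divide_distrib sum_divide_distrib algebra_simps)
    moreover have "?b - 2 * (\<Sum>j | j < d div 2. (-1) ^ j / of_nat (2 * j + 1))
          + 3 * (\<Sum>j | j < d div 2 \<and> \<not> 3 dvd (int p - 2 * int j - 1).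
                  (-1) ^ j / of_nat (2 * j + 1)) =
      ?b + of_int (- 1) * (\<Sum>i<j. of_int ((-1) ^ i) * ?u i)"
    proof -
      have eq: "{i. i < d div 2} = {..<j}"
        "{i. i < d div 2 \<and> \<not> 3 dvd (int p - 2 * int i - 1)} = {i \<in> {..<j}. \<not> 3 dvd (int p - 2 * int i - 1)}"
        by (auto simp: d)
      \<comment> \<open>Each i has weight -2 or -2 + 3 = 1, minus the numerator of
        \<open>?u i\<close>.\<close>
      have "- 2 * (\<Sum>i<j. (-1) ^ i / of_nat (2 * i + 1))
          + 3 * (\<Sum>i \<in> {i \<in> {..<j}. \<not> 3 dvd (int p - 2 * int i - 1)}. (-1) ^ i / of_nat (2 * i + 1))
        = (\<Sum>i<j. - 2 * ((-1) ^ i / of_nat (2 * i + 1))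
            + 3 * (if \<not> 3 dvd (int p - 2 * int i - 1) then (-1) ^ i / of_nat (2 * i + 1) else 0 :: rat))"
        by (simp only: sum.inter_filter sum.distrib sum_distrib_left finite_lessThan)
      also have "\<dots> = (\<Sum>i<j. - (of_int ((-1) ^ i) * ?u i))"
        by (intro sum.cong) auto
      finally show ?thesis
        unfolding eq by (simp add: sum_negf)
    qed
    ultimately show "rat_cong p
        (1 / of_nat p *
          of_int ((-1) ^ (d div 2) * (\<Sum>k = 0..p - 1. trinomial k (int d))
            - (-1) ^ ((p - 1) div 2)))
        (?b - 2 * (\<Sum>j | j < d div 2. (-1) ^ j / of_nat (2 * j + 1))
          + 3 * (\<Sum>j | j < d div 2 \<and> \<not> 3 dvd (int p - 2 * int j - 1).
                  (-1) ^ j / of_nat (2 * j + 1)))"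
      unfolding F by (simp only:)
  }
qed

end
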